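(* Let $f\colon\mathbb{N}^2\to\mathbb{N}$ be any max-dominating pairing function. Define $\xi_f$ on $\mathbb{N}$ by $\xi_f(0)=()$ and, for each pair $(x,y)\in\mathbb{N}^2$, $$\xi_f(f(x,y)+1)=\begin{cases} (y) & \text{if } x=0,\\ (\xi_f(x),y) & \text{otherwise},\end{cases}$$ where $(y)$ is the length-one sequence and, if $\xi_f(x)=(v_1,\ldots,v_k)$, then $(\xi_f(x),y)$ denotes the sequence $(v_1,\ldots,v_k,y)$. Then $\xi_f$ is an enumeration of $\mathbb{N}^*$, i.e. a bijection from $\mathbb{N}$ onto $\mathbb{N}^*$.
   Context: $\mathbb{N}$ denotes the set of non-negative integers. A pairing function for $\mathbb{N}$ is a bijection $\mathbb{N}^2\to\mathbb{N}$; it is max-dominating if $\max(x,y)\le f(x,y)$ for all $(x,y)$. $\mathbb{N}^*=\{()\}\cup\mathbb{N}^1\cup\mathbb{N}^2\cup\cdots$ is the set of all finite-length sequences of non-negative integers, where $()$ is the empty sequence; sequences of different lengths are distinct elements of $\mathbb{N}^*$. (Since $x\le f(x,y)<f(x,y)+1$, the recursion defining $\xi_f$ refers only to smaller arguments.) *)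

theory Defs
  imports Main
begin

definition pairing_function :: "(nat \<times> nat \<Rightarrow> nat) \<Rightarrow> bool" where
  "pairing_function f \<longleftrightarrow> bij f"

definition max_dominating :: "(nat \<times> nat \<Rightarrow> nat) \<Rightarrow> bool" where
  "max_dominating f \<longleftrightarrow> (\<forall>x y. max x y \<le> f (x, y))"

text \<open>Since \<open>f\<close> is a bijection, \<open>n\<close> is \<open>f (x, y)\<close> for \<open>(x, y) = inv f n\<close>, so the second equation
  gives the value at \<open>f (x, y) + 1\<close>. The test \<open>x \<le> n\<close> only makes the recursion terminate for
  arbitrary \<open>f\<close>; it is always true for a max-dominating pairing function, and then \<open>xi f\<close> is the
  unique function satisfying the two intended equations, as shown by the lemmas below.\<close>

fun xi :: "(nat \<times> nat \<Rightarrow> nat) \<Rightarrow> nat \<Rightarrow> nat list" where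
  "xi f 0 = []"
| "xi f (Suc n) =
     (case inv f n of (x, y) \<Rightarrow>
        if x = 0 then [y] else if x \<le> n then xi f x @ [y] else undefined)"

lemma xi_pair:
  assumes "pairing_function f" and "max_dominating f"
  shows "xi f (f (x, y) + 1) = (if x = 0 then [y] else xi f x @ [y])"
proof -
  have "inv f (f (x, y)) = (x, y)"
    using assms(1) by (simp add: pairing_function_def bij_is_inj)
  moreover have "x \<le> f (x, y)"
    using assms(2) by (auto simp: max_dominating_def)
  ultimately show ?thesis by simp
qed

lemma xi_unique:
  assumes "pairing_function f" and "max_dominating f"
    and zero: "g 0 = []"
    and pair: "\<And>x y. g (f (x, y) + 1) = (if x = 0 then [y] else g x @ [y])"
  shows "g = xi f"
proof
  fix n
  show "g n = xi f n"
  proof (induction n rule: less_induct)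
    case (less n)
    show ?case
    proof (cases n)
      case 0
      then show ?thesis using zero by simp
    next
      case (Suc m)
      obtain x y where m: "m = f (x, y)"
        using assms(1) by (metis pairing_function_def bij_pointE surj_pair)
      have "x < n"
        using assms(2) Suc m by (auto simp: max_dominating_def less_Suc_eq_le)
      then have "g x = xi f x" by (rule less.IH)
      then show ?thesis
        using pair[of x y] xi_pair[OF assms(1,2), of x y] Suc m by simp
    qed
  qed
qed

end

theory Submission
  imports Defs
begin

text \<open>Since \<open>xi f 0 = []\<close>, the two cases of the recursion merge into
  \<open>xi f (f (x, y) + 1) = xi f x @ [y]\<close>. So \<open>0\<close> codes the empty sequence, every positive
  number is uniquely \<open>f (x, y) + 1\<close>, and every nonempty sequence is uniquely \<open>us @ [y]\<close>;
  bijectivity follows by induction on the length of the sequence.\<close>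

lemma xi_snoc:
  assumes "pairing_function f" and "max_dominating f"
  shows "xi f (Suc (f (x, y))) = xi f x @ [y]"
  using xi_pair[OF assms, of x y] by (auto simp del: xi.simps(2))

text \<open>Surjectivity of \<open>f\<close>, applied to the predecessor of a positive
  \<open>n\<close>, provides the pair.\<close>

lemma pairing_function_cases:
  assumes "pairing_function f"
  obtains (zero) "n = 0" | (pair) x y where "n = Suc (f (x, y))"
  using assms by (metis bij_pointE not0_implies_Suc pairing_function_def surj_pair)

theorem theorem10:
  fixes f :: "nat \<times> nat \<Rightarrow> nat"
  assumes "pairing_function f" and "max_dominating f"
  shows "bij_betw (xi f) (UNIV :: nat set) (UNIV :: nat list set)"
proof -
  have "\<exists>!n. xi f n = vs" for vs
  \<comment> \<open>The recursion appends on the right, hence reverse induction. The step needs both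
    existence and uniqueness of the code of \<open>us\<close>.\<close>
  proof (induction vs rule: rev_induct)
    case Nil
    show ?case
    proof (rule ex1I[of _ 0])
      fix n
      assume "xi f n = []"
      then show "n = 0"
        by (cases n rule: pairing_function_cases[OF assms(1)])
          (simp_all add: xi_snoc[OF assms] del: xi.simps(2))
    qed simp
  next
    case (snoc y us)
    then obtain x where x: "xi f x = us" and unique: "\<And>x'. xi f x' = us \<Longrightarrow> x' = x"
      by blast
    show ?case
    proof (rule ex1I[of _ "Suc (f (x, y))"])
      show "xi f (Suc (f (x, y))) = us @ [y]"
        using x by (simp add: xi_snoc[OF assms] del: xi.simps(2))
    next
      fix n
      assume "xi f n = us @ [y]"
      \<comment> \<open>The code 0 gives the empty list. For \<open>n = Suc (f (x', y'))\<close>,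
        comparing last entries gives \<open>y' = y\<close> and \<open>xi f x' = us\<close>, so
        \<open>x' = x\<close> by \<open>unique\<close>.\<close>
      then show "n = Suc (f (x, y))"
        by (cases n rule: pairing_function_cases[OF assms(1)])
          (auto simp: xi_snoc[OF assms] dest: unique[OF sym] simp del: xi.simps(2))
    qed
  qed
  then show ?thesis
    by (metis bij_iff)
qed

end
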